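(* Let $\mathcal G$ be a finite connected graph with edge set $\mathcal E$, with Kirchhoff conditions at interior vertices and a fixed Dirichlet or Neumann condition at each exterior vertex. Let $K\subsetneq\mathcal G$ be a proper simple path joining two exterior vertices or a proper simple cycle, and let $\ell^\star\in(0,\infty)^{\mathcal E}$, $k_\star>0$ and $\phi_K^\star$ be such that $-\Delta_{\mathcal G,\ell^\star}\phi_K^\star=k_\star^2\phi_K^\star$ and $\operatorname{supp}\phi_K^\star=K$. Assume that the space of $k_\star^2$-eigenfunctions of $-\Delta_{\mathcal G,\ell^\star}$ supported entirely on $K$ is one-dimensional, spanned by $\phi_K^\star$. Then the off-support lengths may be perturbed arbitrarily slightly so that $k_\star^2$ remains an eigenvalue with eigenfunction $\phi_K^\star$ and becomes simple; that is, for every $\varepsilon>0$ there is $\ell\in(0,\infty)^{\mathcal E}$ with $\ell_e=\ell^\star_e$ for $e\subset K$ and $|\ell_e-\ell_e^\star|<\varepsilon$ for $e\not\subset K$, such that $k_\star^2$ is a simple eigenvalue of $-\Delta_{\mathcal G,\ell}$ with eigenfunction $\phi_K^\star$ (its restriction to $K$ extended by zero to all edges not in $K$).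
   Context: Loops and parallel edges are allowed; a loop is a one-edge simple cycle and two parallel edges may form a two-edge simple cycle. A vertex is exterior if it has degree one (loops count twice), interior otherwise. For $\ell\in(0,\infty)^{\mathcal E}$ each edge $e$ is identified with $[0,\ell_e]$, and $-\Delta_{\mathcal G,\ell}$ is the self-adjoint operator on $\bigoplus_eL^2(0,\ell_e)$ acting as $-u''$ on each edge, on edgewise $H^2$ functions that at each interior vertex are continuous and have vanishing sum of normal derivatives (Kirchhoff), and at each exterior vertex $v$ satisfy the fixed prescribed condition, $u(v)=0$ (Dirichlet) or $\partial_\nu u(v)=0$ (Neumann). *)

theory Defs
  imports "HOL-Analysis.Analysis" "Graph_Theory.Digraph_Component"
begin

text \<open>
  A finite undirected multigraph (loops and parallel edges allowed) is a \<^locale>\<open>fin_digraph\<close>.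
  The direction of an arc \<open>e\<close> only fixes the identification of the edge with \<open>[0, \<l> e]\<close>:
  \<open>tail G e\<close> sits at \<open>0\<close> and \<open>head G e\<close> at \<open>\<l> e\<close>. All notions below ignore it otherwise, in
  particular connectedness is \<^const>\<open>Digraph_Component.connected\<close>, which symmetrises the graph.
\<close>

definition exterior :: "('v, 'e) pre_digraph \<Rightarrow> 'v \<Rightarrow> bool" where
  "exterior G v \<longleftrightarrow> v \<in> verts G \<and> in_degree G v + out_degree G v = 1"

definition interior_vertex :: "('v, 'e) pre_digraph \<Rightarrow> 'v \<Rightarrow> bool" where
  "interior_vertex G v \<longleftrightarrow> v \<in> verts G \<and> \<not> exterior G v"

definition joins :: "('v, 'e) pre_digraph \<Rightarrow> 'e \<Rightarrow> 'v \<Rightarrow> 'v \<Rightarrow> bool" where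
  "joins G e v w \<longleftrightarrow>
     tail G e = v \<and> head G e = w \<or> tail G e = w \<and> head G e = v"

text \<open>The edge sequence \<open>es\<close> runs through the vertices \<open>vs\<close>, each edge in either direction.\<close>

definition undirected_walk :: "('v, 'e) pre_digraph \<Rightarrow> 'v list \<Rightarrow> 'e list \<Rightarrow> bool" where
  "undirected_walk G vs es \<longleftrightarrow>
     set vs \<subseteq> verts G \<and> set es \<subseteq> arcs G \<and> length vs = Suc (length es) \<and>
     (\<forall>i < length es. joins G (es ! i) (vs ! i) (vs ! Suc i))"

text \<open>Paths and cycles are given by their edge sets.\<close>

definition simple_exterior_path :: "('v, 'e) pre_digraph \<Rightarrow> 'e set \<Rightarrow> bool" where
  "simple_exterior_path G K \<longleftrightarrow>
     (\<exists>vs es. undirected_walk G vs es \<and> set es = K \<and> es \<noteq> [] \<and> distinct vs \<and>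
        exterior G (hd vs) \<and> exterior G (last vs))"

text \<open>
  Distinctness of the edges excludes going back and forth along one edge; a loop gives
  \<open>vs = [v, v]\<close> and two parallel edges give \<open>vs = [v, w, v]\<close>.
\<close>

definition simple_cycle :: "('v, 'e) pre_digraph \<Rightarrow> 'e set \<Rightarrow> bool" where
  "simple_cycle G K \<longleftrightarrow>
     (\<exists>vs es. undirected_walk G vs es \<and> set es = K \<and> es \<noteq> [] \<and>
        hd vs = last vs \<and> distinct (tl vs) \<and> distinct es)"

text \<open>
  A function on the metric graph is \<open>u :: 'e \<Rightarrow> real \<Rightarrow> complex\<close>, with \<open>u e x\<close> relevant for
  \<open>e \<in> arcs G\<close> and \<open>x \<in> [0, \<l> e]\<close> only. Normalising it to \<open>0\<close> elsewhere makes HOL equality the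
  equality of functions on the graph.
\<close>

definition graph_functions ::
  "('v, 'e) pre_digraph \<Rightarrow> ('e \<Rightarrow> real) \<Rightarrow> ('e \<Rightarrow> real \<Rightarrow> complex) set" where
  "graph_functions G \<l> = {u. \<forall>e x. \<not> (e \<in> arcs G \<and> x \<in> {0..\<l> e}) \<longrightarrow> u e x = 0}"

definition square_integrable_on :: "(real \<Rightarrow> complex) \<Rightarrow> real set \<Rightarrow> bool" where
  "square_integrable_on g S \<longleftrightarrow>
     set_borel_measurable lebesgue S g \<and> set_integrable lebesgue S (\<lambda>t. (cmod (g t))\<^sup>2)"

text \<open>
  \<open>f \<in> H\<^sup>2(0, L)\<close> with weak second derivative \<open>g \<in> L\<^sup>2(0, L)\<close>, where \<open>f\<close> is the
  representative that is \<open>C\<^sup>1\<close> up to the boundary with absolutely continuous derivative. The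
  condition depends on \<open>g\<close> only up to null sets.
\<close>

definition has_H2_second_derivative ::
  "real \<Rightarrow> (real \<Rightarrow> complex) \<Rightarrow> (real \<Rightarrow> complex) \<Rightarrow> bool" where
  "has_H2_second_derivative L f g \<longleftrightarrow>
     square_integrable_on g {0..L} \<and>
     (\<exists>f'. \<forall>x \<in> {0..L}.
        (f has_vector_derivative f' x) (at x within {0..L}) \<and>
        f' x = f' 0 + (LINT t:{0..x}|lebesgue. g t))"

datatype boundary_condition = Dirichlet | Neumann

text \<open>Each loop at \<open>v\<close> contributes both of its ends, hence one term to each of the two sums.\<close>

definition normal_derivative_sum ::
  "('v, 'e) pre_digraph \<Rightarrow> ('e \<Rightarrow> real) \<Rightarrow> ('e \<Rightarrow> real \<Rightarrow> complex) \<Rightarrow> 'v \<Rightarrow> complex" where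
  "normal_derivative_sum G \<l> u v =
     (\<Sum>e \<in> in_arcs G v. vector_derivative (u e) (at (\<l> e) within {0..\<l> e})) -
     (\<Sum>e \<in> out_arcs G v. vector_derivative (u e) (at 0 within {0..\<l> e}))"

definition has_vertex_value ::
  "('v, 'e) pre_digraph \<Rightarrow> ('e \<Rightarrow> real) \<Rightarrow> ('e \<Rightarrow> real \<Rightarrow> complex) \<Rightarrow> 'v \<Rightarrow> complex \<Rightarrow> bool" where
  "has_vertex_value G \<l> u v c \<longleftrightarrow>
     (\<forall>e \<in> out_arcs G v. u e 0 = c) \<and> (\<forall>e \<in> in_arcs G v. u e (\<l> e) = c)"

text \<open>At an exterior vertex \<^const>\<open>normal_derivative_sum\<close> has a single term.\<close>

definition vertex_conditions ::
  "('v, 'e) pre_digraph \<Rightarrow> ('v \<Rightarrow> boundary_condition) \<Rightarrow> ('e \<Rightarrow> real) \<Rightarrow>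
     ('e \<Rightarrow> real \<Rightarrow> complex) \<Rightarrow> bool" where
  "vertex_conditions G bc \<l> u \<longleftrightarrow>
     (\<forall>v. interior_vertex G v \<longrightarrow>
        (\<exists>c. has_vertex_value G \<l> u v c) \<and> normal_derivative_sum G \<l> u v = 0) \<and>
     (\<forall>v. exterior G v \<longrightarrow>
        (case bc v of
           Dirichlet \<Rightarrow> has_vertex_value G \<l> u v 0
         | Neumann \<Rightarrow> normal_derivative_sum G \<l> u v = 0))"

text \<open>The graph of the unbounded operator: \<open>u\<close> lies in its domain and \<open>- \<Delta> u = w\<close>.\<close>

definition neg_laplacian ::
  "('v, 'e) pre_digraph \<Rightarrow> ('v \<Rightarrow> boundary_condition) \<Rightarrow> ('e \<Rightarrow> real) \<Rightarrow>
     ('e \<Rightarrow> real \<Rightarrow> complex) \<Rightarrow> ('e \<Rightarrow> real \<Rightarrow> complex) \<Rightarrow> bool" where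
  "neg_laplacian G bc \<l> u w \<longleftrightarrow>
     (\<forall>e \<in> arcs G. has_H2_second_derivative (\<l> e) (u e) (\<lambda>x. - w e x)) \<and>
     vertex_conditions G bc \<l> u"

definition scale_fun :: "complex \<Rightarrow> ('e \<Rightarrow> real \<Rightarrow> complex) \<Rightarrow> 'e \<Rightarrow> real \<Rightarrow> complex" where
  "scale_fun c u = (\<lambda>e x. c * u e x)"

definition eigenspace ::
  "('v, 'e) pre_digraph \<Rightarrow> ('v \<Rightarrow> boundary_condition) \<Rightarrow> ('e \<Rightarrow> real) \<Rightarrow> real \<Rightarrow>
     ('e \<Rightarrow> real \<Rightarrow> complex) set" where
  "eigenspace G bc \<l> \<mu> =
     {u \<in> graph_functions G \<l>. neg_laplacian G bc \<l> u (scale_fun (of_real \<mu>) u)}"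

definition eigenfunction ::
  "('v, 'e) pre_digraph \<Rightarrow> ('v \<Rightarrow> boundary_condition) \<Rightarrow> ('e \<Rightarrow> real) \<Rightarrow> real \<Rightarrow>
     ('e \<Rightarrow> real \<Rightarrow> complex) \<Rightarrow> bool" where
  "eigenfunction G bc \<l> \<mu> u \<longleftrightarrow> u \<in> eigenspace G bc \<l> \<mu> \<and> u \<noteq> (\<lambda>e x. 0)"

definition one_dimensional_spanned_by ::
  "('e \<Rightarrow> real \<Rightarrow> complex) set \<Rightarrow> ('e \<Rightarrow> real \<Rightarrow> complex) \<Rightarrow> bool" where
  "one_dimensional_spanned_by V u \<longleftrightarrow> u \<noteq> (\<lambda>e x. 0) \<and> V = range (\<lambda>c. scale_fun c u)"

definition simple_eigenvalue ::
  "('v, 'e) pre_digraph \<Rightarrow> ('v \<Rightarrow> boundary_condition) \<Rightarrow> ('e \<Rightarrow> real) \<Rightarrow> real \<Rightarrow> bool" where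
  "simple_eigenvalue G bc \<l> \<mu> \<longleftrightarrow>
     (\<exists>u. one_dimensional_spanned_by (eigenspace G bc \<l> \<mu>) u)"

text \<open>
  Subsets of the metric graph are represented in the disjoint union of the closed edges
  \<open>{e} \<times> [0, \<l> e]\<close>, before the ends of edges are glued. For functions that are continuous on the
  glued graph, having support equal to, or contained in, a union of closed edges means the same
  before and after gluing.
\<close>

definition edge_points :: "('e \<Rightarrow> real) \<Rightarrow> 'e set \<Rightarrow> ('e \<times> real) set" where
  "edge_points \<l> K = (SIGMA e:K. {0..\<l> e})"

definition graph_support ::
  "('v, 'e) pre_digraph \<Rightarrow> ('e \<Rightarrow> real) \<Rightarrow> ('e \<Rightarrow> real \<Rightarrow> complex) \<Rightarrow> ('e \<times> real) set" where
  "graph_support G \<l> u = (SIGMA e:arcs G. closure {x \<in> {0..\<l> e}. u e x \<noteq> 0})"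

definition extend_by_zero :: "'e set \<Rightarrow> ('e \<Rightarrow> real \<Rightarrow> complex) \<Rightarrow> 'e \<Rightarrow> real \<Rightarrow> complex" where
  "extend_by_zero K u = (\<lambda>e x. if e \<in> K then u e x else 0)"

end

theory Submission
  imports Defs
begin

text \<open>
  Lengthen all edges outside \<open>K\<close> by the same \<open>t > 0\<close>. On each edge an eigenfunction is
  \<open>a cos (k (x - l/2)) + b sin (k (x - l/2))\<close> with the midpoint as origin. For eigenfunctions
  belonging to two parameters \<open>s\<close> and \<open>t\<close>, Green's identity turns the vertex conditions into
  \<open>sin (k (t - s) / 2) * (\<Sum>e. a\<^sub>e * cnj a'\<^sub>e + b\<^sub>e * cnj b'\<^sub>e) = 0\<close>, the sum ranging over the edges
  outside \<open>K\<close>. So the midpoint data outside \<open>K\<close> for different small parameters are orthogonal in a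
  finite-dimensional space, and for all but finitely many \<open>t\<close> every eigenfunction vanishes outside
  \<open>K\<close>. Such an eigenfunction does not feel the lengths outside \<open>K\<close>, hence is a multiple of \<open>\<phi>\<close>.
\<close>

section \<open>Orthogonal families in a finite-dimensional space\<close>

text \<open>Double counting of the squared moduli of all coordinates: summed over \<open>I\<close>
  first they give \<open>card T\<close>, since each vector has norm one; summed over
  \<open>T\<close> first each coordinate contributes at most 1, by Bessel's inequality for a
  standard unit vector.\<close>

lemma card_orthonormal_le:
  fixes w :: "'t \<Rightarrow> 'i \<Rightarrow> complex"
  assumes "finite T" "finite I"
    and orth: "\<And>s t. s \<in> T \<Longrightarrow> t \<in> T \<Longrightarrow>
      (\<Sum>i\<in>I. w s i * cnj (w t i)) = (if s = t then 1 else 0)"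
  shows "card T \<le> card I"
proof -
  have bessel: "(\<Sum>t\<in>T. (cmod (w t j))\<^sup>2) \<le> 1" if j: "j \<in> I" for j
  proof -
    \<comment> \<open>\<open>q\<close> is the orthogonal projection of the \<open>j\<close>-th unit
      vector onto the span of the family. Its \<open>j\<close>-th coordinate and its squared norm
      both equal \<open>p\<close>, whence \<open>p * p \<le> p\<close>.\<close>
    define p where "p = (\<Sum>t\<in>T. (cmod (w t j))\<^sup>2)"
    define q where "q i = (\<Sum>t\<in>T. w t i * cnj (w t j))" for i
    have qj: "q j = of_real p"
      unfolding q_def p_def by (simp flip: complex_norm_square)
    have "(\<Sum>i\<in>I. q i * cnj (q i)) =
        (\<Sum>i\<in>I. \<Sum>s\<in>T. \<Sum>t\<in>T. (cnj (w s j) * w t j) * (w s i * cnj (w t i)))"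
      unfolding q_def cnj_sum sum_product by (intro sum.cong) (auto simp: algebra_simps)
    also have "\<dots> = (\<Sum>s\<in>T. \<Sum>t\<in>T. (cnj (w s j) * w t j) * (\<Sum>i\<in>I. w s i * cnj (w t i)))"
      unfolding sum_distrib_left by (subst sum.swap, intro sum.cong refl, rule sum.swap)
    also have "\<dots> = (\<Sum>s\<in>T. \<Sum>t\<in>T. (cnj (w s j) * w t j) * (if s = t then 1 else 0))"
      by (intro sum.cong refl) (simp add: orth)
    also have "\<dots> = (\<Sum>s\<in>T. cnj (w s j) * w s j)"
      using assms(1) by (simp add: if_distrib cong: if_cong)
    also have "\<dots> = of_real p"
      unfolding p_def by (simp add: mult.commute flip: complex_norm_square)
    finally have "of_real (\<Sum>i\<in>I. (cmod (q i))\<^sup>2) = complex_of_real p"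
      by (simp flip: complex_norm_square)
    then have "(\<Sum>i\<in>I. (cmod (q i))\<^sup>2) = p"
      using of_real_eq_iff by blast
    moreover have "(cmod (q j))\<^sup>2 \<le> (\<Sum>i\<in>I. (cmod (q i))\<^sup>2)"
      using j assms(2) by (intro member_le_sum) auto
    ultimately have "p * p \<le> 1 * p"
      unfolding qj by (simp add: power2_eq_square)
    moreover have "0 \<le> p"
      unfolding p_def by (intro sum_nonneg) auto
    ultimately have "p \<le> 1"
      by (metis mult_right_le_imp_le order_le_less zero_le_one)
    then show ?thesis unfolding p_def .
  qed
  have "complex_of_real (real (card T)) = (\<Sum>t\<in>T. \<Sum>i\<in>I. w t i * cnj (w t i))"
    by (simp add: orth)
  also have "\<dots> = of_real (\<Sum>t\<in>T. \<Sum>i\<in>I. (cmod (w t i))\<^sup>2)"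
    by (simp flip: complex_norm_square)
  finally have "real (card T) = (\<Sum>t\<in>T. \<Sum>i\<in>I. (cmod (w t i))\<^sup>2)"
    using of_real_eq_iff by blast
  also have "\<dots> = (\<Sum>i\<in>I. \<Sum>t\<in>T. (cmod (w t i))\<^sup>2)"
    by (rule sum.swap)
  also have "\<dots> \<le> (\<Sum>i\<in>I. 1)"
    by (intro sum_mono bessel)
  finally show ?thesis by simp
qed

text \<open>Dividing each vector by its norm \<open>r t\<close>, positive by \<open>nz\<close>,
  reduces this to the orthonormal case.\<close>

lemma card_orthogonal_le:
  fixes w :: "'t \<Rightarrow> 'i \<Rightarrow> complex"
  assumes "finite T" "finite I"
    and orth: "\<And>s t. s \<in> T \<Longrightarrow> t \<in> T \<Longrightarrow> s \<noteq> t \<Longrightarrow> (\<Sum>i\<in>I. w s i * cnj (w t i)) = 0"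
    and nz: "\<And>t. t \<in> T \<Longrightarrow> \<exists>i\<in>I. w t i \<noteq> 0"
  shows "card T \<le> card I"
proof -
  define r where "r t = sqrt (\<Sum>i\<in>I. (cmod (w t i))\<^sup>2)" for t
  have pos: "r t > 0" if t: "t \<in> T" for t
  proof -
    obtain i where "i \<in> I" "w t i \<noteq> 0" using nz[OF t] by blast
    then have "(\<Sum>i\<in>I. (cmod (w t i))\<^sup>2) > 0"
      using assms(2) by (intro sum_pos2[of I i]) auto
    then show ?thesis unfolding r_def by simp
  qed
  have sq: "(\<Sum>i\<in>I. w t i * cnj (w t i)) = of_real (r t) * of_real (r t)" for t
  proof -
    have "(\<Sum>i\<in>I. w t i * cnj (w t i)) = of_real (\<Sum>i\<in>I. (cmod (w t i))\<^sup>2)"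
      by (simp flip: complex_norm_square)
    also have "(\<Sum>i\<in>I. (cmod (w t i))\<^sup>2) = r t * r t"
      unfolding r_def by (simp add: sum_nonneg)
    finally show ?thesis by simp
  qed
  show ?thesis
  proof (rule card_orthonormal_le[OF assms(1,2)])
    fix s t assume st: "s \<in> T" "t \<in> T"
    have "(\<Sum>i\<in>I. w s i / of_real (r s) * cnj (w t i / of_real (r t))) =
        (\<Sum>i\<in>I. w s i * cnj (w t i)) / (of_real (r s) * of_real (r t))"
      by (simp add: sum_divide_distrib)
    also have "\<dots> = (if s = t then 1 else 0)"
      using pos[OF st(1)] orth[OF st] by (auto simp: sq)
    finally show "(\<Sum>i\<in>I. w s i / of_real (r s) * cnj (w t i / of_real (r t))) =
        (if s = t then 1 else 0)" .
  qed
qed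

section \<open>Eigenfunctions on a single edge\<close>

text \<open>Since \<open>f\<close> is continuous, so is its weak second derivative, and the equation
  holds classically. The point \<open>(k f, f')\<close> then rotates with angular speed
  \<open>k\<close>; undoing the rotation leaves a constant vector, which yields the coefficients.
  The origin \<open>c\<close> is left free so that it can be put at the midpoint of the
  edge.\<close>

lemma H2_harmonic_oscillator:
  fixes f :: "real \<Rightarrow> complex"
  assumes "k > 0" "L > 0"
    and H2: "has_H2_second_derivative L f (\<lambda>x. - (of_real (k\<^sup>2) * f x))"
  obtains a b where
    "\<And>x. x \<in> {0..L} \<Longrightarrow> f x = a * of_real (cos (k * (x - c))) + b * of_real (sin (k * (x - c)))"
    "\<And>x. x \<in> {0..L} \<Longrightarrow> vector_derivative f (at x within {0..L}) =
       of_real k * (b * of_real (cos (k * (x - c))) - a * of_real (sin (k * (x - c))))"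
proof -
  obtain f' where f': "\<And>x. x \<in> {0..L} \<Longrightarrow> (f has_vector_derivative f' x) (at x within {0..L})"
    and int: "\<And>x. x \<in> {0..L} \<Longrightarrow>
      f' x = f' 0 + (LINT t:{0..x}|lebesgue. - (of_real (k\<^sup>2) * f t))"
    using H2 unfolding has_H2_second_derivative_def by blast
  have "continuous_on {0..L} f"
    using f' has_vector_derivative_continuous continuous_on_eq_continuous_within by blast
  then have cont: "continuous_on {0..L} (\<lambda>x. - (of_real (k\<^sup>2) * f x))"
    by (intro continuous_intros)
  \<comment> \<open>For a continuous integrand the Lebesgue integral is a gauge integral, to which
    the fundamental theorem of calculus applies.\<close>
  have int': "f' x = f' 0 + integral {0..x} (\<lambda>x. - (of_real (k\<^sup>2) * f x))" if "x \<in> {0..L}" for x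
  proof -
    have "continuous_on {0..x} (\<lambda>x. - (of_real (k\<^sup>2) * f x))"
      using that by (intro continuous_on_subset[OF cont]) auto
    then show ?thesis
      using int[OF that] set_lebesgue_integral_eq_integral(2) absolutely_integrable_continuous_real
      by metis
  qed
  have f'': "(f' has_vector_derivative - (of_real (k\<^sup>2) * f x)) (at x within {0..L})"
    if x: "x \<in> {0..L}" for x
  proof (rule has_vector_derivative_transform[OF x])
    show "f' y = f' 0 + integral {0..y} (\<lambda>x. - (of_real (k\<^sup>2) * f x))" if "y \<in> {0..L}" for y
      using int'[OF that] .
    show "((\<lambda>y. f' 0 + integral {0..y} (\<lambda>x. - (of_real (k\<^sup>2) * f x))) has_vector_derivative
        - (of_real (k\<^sup>2) * f x)) (at x within {0..L})"
      using has_vector_derivative_add[OF has_vector_derivative_const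
          integral_has_vector_derivative[OF cont x]] by simp
  qed
  define C where "C x = complex_of_real (cos (k * (x - c)))" for x
  define S where "S x = complex_of_real (sin (k * (x - c)))" for x
  have C': "(C has_vector_derivative - (of_real k * S x)) (at x within {0..L})" for x
    unfolding C_def S_def
    by (rule has_vector_derivative_eq_rhs[OF has_vector_derivative_of_real])
      (auto intro!: derivative_eq_intros)
  have S': "(S has_vector_derivative of_real k * C x) (at x within {0..L})" for x
    unfolding C_def S_def
    by (rule has_vector_derivative_eq_rhs[OF has_vector_derivative_of_real])
      (auto intro!: derivative_eq_intros)
  \<comment> \<open>First coordinate of \<open>(k f, f')\<close> after rotating back by the angle
    \<open>k * (x - c)\<close>; the second one follows below. The constants \<open>a\<close> and
    \<open>b\<close> are \<open>k\<close> times the final coefficients.\<close>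
  have "((\<lambda>x. of_real k * (f x * C x) - f' x * S x) has_vector_derivative 0) (at x within {0..L})"
    if x: "x \<in> {0..L}" for x
    by (rule has_vector_derivative_eq_rhs[OF has_vector_derivative_diff[OF
          has_vector_derivative_mult[OF has_vector_derivative_const
            has_vector_derivative_mult[OF f'[OF x] C']]
          has_vector_derivative_mult[OF f''[OF x] S']]])
      (simp add: algebra_simps power2_eq_square)
  then obtain a where a: "\<And>x. x \<in> {0..L} \<Longrightarrow> of_real k * (f x * C x) - f' x * S x = a"
    using has_vector_derivative_zero_constant[OF convex_closed_interval, of 0 L] by blast
  have "((\<lambda>x. of_real k * (f x * S x) + f' x * C x) has_vector_derivative 0) (at x within {0..L})"
    if x: "x \<in> {0..L}" for x
    by (rule has_vector_derivative_eq_rhs[OF has_vector_derivative_add[OF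
          has_vector_derivative_mult[OF has_vector_derivative_const
            has_vector_derivative_mult[OF f'[OF x] S']]
          has_vector_derivative_mult[OF f''[OF x] C']]])
      (simp add: algebra_simps power2_eq_square)
  then obtain b where b: "\<And>x. x \<in> {0..L} \<Longrightarrow> of_real k * (f x * S x) + f' x * C x = b"
    using has_vector_derivative_zero_constant[OF convex_closed_interval, of 0 L] by blast
  have CS: "C x * C x + S x * S x = 1" for x
    by (simp only: C_def S_def of_real_mult[symmetric] of_real_add[symmetric]
        sin_cos_squared_add3 of_real_1)
  show thesis
  proof
    fix x assume x: "x \<in> {0..L}"
    have "of_real k * f x = of_real k * f x * (C x * C x + S x * S x)" by (simp add: CS)
    also have "\<dots> = a * C x + b * S x"
      unfolding a[OF x, symmetric] b[OF x, symmetric] by (simp add: algebra_simps)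
    finally have "f x = a / of_real k * C x + b / of_real k * S x"
      using \<open>k > 0\<close> by (simp add: field_simps)
    then show "f x = a / of_real k * of_real (cos (k * (x - c))) +
        b / of_real k * of_real (sin (k * (x - c)))"
      unfolding C_def S_def .
    have "f' x = f' x * (C x * C x + S x * S x)" by (simp add: CS)
    also have "\<dots> = b * C x - a * S x"
      unfolding a[OF x, symmetric] b[OF x, symmetric] by (simp add: algebra_simps)
    also have "\<dots> = of_real k * (b / of_real k * C x - a / of_real k * S x)"
      using \<open>k > 0\<close> by (simp add: right_diff_distrib)
    \<comment> \<open>\<open>L > 0\<close> makes the derivative within the interval unique, also at
      its ends.\<close>
    finally show "vector_derivative f (at x within {0..L}) = of_real k *
        (b / of_real k * of_real (cos (k * (x - c))) - a / of_real k * of_real (sin (k * (x - c))))"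
      using vector_derivative_within_cbox[of 0 L x f "f' x"] f'[OF x] x \<open>L > 0\<close>
      unfolding C_def S_def by simp
  qed
qed

section \<open>Green's identity on the graph\<close>

abbreviation edge_deriv :: "('e \<Rightarrow> real) \<Rightarrow> ('e \<Rightarrow> real \<Rightarrow> complex) \<Rightarrow> 'e \<Rightarrow> real \<Rightarrow> complex" where
  "edge_deriv \<l> u e x \<equiv> vector_derivative (u e) (at x within {0..\<l> e})"

text \<open>The vertex conditions involve only values and derivatives at edge ends, so functions for
  two different length vectors can be paired. The boundary terms cancel at each vertex separately;
  grouping edges by head on one side and by tail on the other then covers every edge end once, loops
  included.\<close>

lemma (in fin_digraph) green_identity:
  assumes u: "vertex_conditions G bc \<l> u" and v: "vertex_conditions G bc \<l>' v"
  shows "(\<Sum>e\<in>arcs G. edge_deriv \<l> u e (\<l> e) * cnj (v e (\<l>' e)) - u e (\<l> e) * cnj (edge_deriv \<l>' v e (\<l>' e)))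
    = (\<Sum>e\<in>arcs G. edge_deriv \<l> u e 0 * cnj (v e 0) - u e 0 * cnj (edge_deriv \<l>' v e 0))"
    (is "sum ?h _ = sum ?t _")
proof -
  have "sum ?h (in_arcs G x) = sum ?t (out_arcs G x)" if x: "x \<in> verts G" for x
  proof -
    \<comment> \<open>With common values \<open>c\<close> and \<open>d\<close> at the vertex the
      boundary terms depend on the derivatives only through their normal sums. This serves both
      Kirchhoff and Dirichlet vertices.\<close>
    have vertex: ?thesis
      if "has_vertex_value G \<l> u x c" "has_vertex_value G \<l>' v x d"
        "c * cnj (normal_derivative_sum G \<l>' v x) = normal_derivative_sum G \<l> u x * cnj d" for c d
    proof -
      have "sum ?h (in_arcs G x) = (\<Sum>e\<in>in_arcs G x.
          edge_deriv \<l> u e (\<l> e) * cnj d - c * cnj (edge_deriv \<l>' v e (\<l>' e)))"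
        using that(1,2) by (intro sum.cong) (auto simp: has_vertex_value_def)
      moreover have "sum ?t (out_arcs G x) = (\<Sum>e\<in>out_arcs G x.
          edge_deriv \<l> u e 0 * cnj d - c * cnj (edge_deriv \<l>' v e 0))"
        using that(1,2) by (intro sum.cong) (auto simp: has_vertex_value_def)
      ultimately show ?thesis
        using that(3)
        by (simp add: normal_derivative_sum_def sum_subtractf flip: sum_distrib_left sum_distrib_right)
          (simp add: algebra_simps)
    qed
    show ?thesis
    proof (cases "exterior G x")
      case False
      then have int: "interior_vertex G x" using x by (simp add: interior_vertex_def)
      obtain c d where "has_vertex_value G \<l> u x c" "has_vertex_value G \<l>' v x d"
        using int u v unfolding vertex_conditions_def by meson
      moreover have "normal_derivative_sum G \<l> u x = 0" "normal_derivative_sum G \<l>' v x = 0"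
        using int u v unfolding vertex_conditions_def by auto
      ultimately show ?thesis by (intro vertex[of c d]) auto
    next
      case ext: True
      show ?thesis
      proof (cases "bc x")
        case Dirichlet
        then have "has_vertex_value G \<l> u x 0" "has_vertex_value G \<l>' v x 0"
          using ext u v unfolding vertex_conditions_def by fastforce+
        then show ?thesis by (rule vertex) simp
      next
        case Neumann
        \<comment> \<open>A Neumann condition supplies no vertex value, but degree one leaves a
          single edge end, so the vanishing sum is the vanishing of the derivative itself.\<close>
        then have nds: "normal_derivative_sum G \<l> u x = 0" "normal_derivative_sum G \<l>' v x = 0"
          using ext u v unfolding vertex_conditions_def by fastforce+
        have "card (in_arcs G x) + card (out_arcs G x) = 1"
          using ext by (simp add: exterior_def in_degree_def out_degree_def)
        then have "card (in_arcs G x) = 1 \<and> card (out_arcs G x) = 0 \<or>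
            card (in_arcs G x) = 0 \<and> card (out_arcs G x) = 1"
          by arith
        then consider e where "in_arcs G x = {e}" "out_arcs G x = {}"
          | e where "in_arcs G x = {}" "out_arcs G x = {e}"
          by (auto elim!: card_1_singletonE simp: finite_in_arcs finite_out_arcs simp del: One_nat_def)
        then show ?thesis
          using nds by cases (simp_all add: normal_derivative_sum_def)
      qed
    qed
  qed
  then have "(\<Sum>x\<in>verts G. sum ?h {e \<in> arcs G. head G e = x}) =
      (\<Sum>x\<in>verts G. sum ?t {e \<in> arcs G. tail G e = x})"
    by (intro sum.cong[OF refl]) (simp add: in_arcs_def out_arcs_def)
  moreover have "(\<Sum>x\<in>verts G. sum ?h {e \<in> arcs G. head G e = x}) = sum ?h (arcs G)"
    by (rule sum.group) auto
  moreover have "(\<Sum>x\<in>verts G. sum ?t {e \<in> arcs G. tail G e = x}) = sum ?t (arcs G)"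
    by (rule sum.group) auto
  ultimately show ?thesis by simp
qed

section \<open>Midpoint data and their orthogonality\<close>

text \<open>Centring at the midpoint splits \<open>f\<close> into an even part \<open>a\<close> and
  an odd part \<open>b\<close>. With the origin at an end, mixed products of cosine and sine
  coefficients would survive in the Wronskian.\<close>

definition midpoint_form ::
  "real \<Rightarrow> real \<Rightarrow> (real \<Rightarrow> complex) \<Rightarrow> complex \<Rightarrow> complex \<Rightarrow> bool" where
  "midpoint_form k L f a b \<longleftrightarrow> (\<forall>x \<in> {0..L}.
     f x = a * of_real (cos (k * (x - L / 2))) + b * of_real (sin (k * (x - L / 2))) \<and>
     vector_derivative f (at x within {0..L}) =
       of_real k * (b * of_real (cos (k * (x - L / 2))) - a * of_real (sin (k * (x - L / 2)))))"

lemma eigenspace_midpoint_form: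
  assumes "u \<in> eigenspace G bc \<l> (k\<^sup>2)" "k > 0" "\<forall>e \<in> arcs G. \<l> e > 0"
  obtains a b where "\<And>e. e \<in> arcs G \<Longrightarrow> midpoint_form k (\<l> e) (u e) (a e) (b e)"
proof -
  have "\<exists>a b. midpoint_form k (\<l> e) (u e) a b" if e: "e \<in> arcs G" for e
  proof -
    have "has_H2_second_derivative (\<l> e) (u e) (\<lambda>x. - (of_real (k\<^sup>2) * u e x))"
      using assms(1) e by (simp add: eigenspace_def neg_laplacian_def scale_fun_def)
    then obtain a b where
      "\<And>x. x \<in> {0..\<l> e} \<Longrightarrow> u e x =
         a * of_real (cos (k * (x - \<l> e / 2))) + b * of_real (sin (k * (x - \<l> e / 2)))"
      "\<And>x. x \<in> {0..\<l> e} \<Longrightarrow> edge_deriv \<l> u e x =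
         of_real k * (b * of_real (cos (k * (x - \<l> e / 2))) - a * of_real (sin (k * (x - \<l> e / 2))))"
      using H2_harmonic_oscillator[of k "\<l> e" "u e" "\<l> e / 2"] assms(2,3) e by blast
    then show ?thesis unfolding midpoint_form_def by blast
  qed
  then show ?thesis using that by metis
qed

text \<open>By parity the mixed products cancel between the two ends, while the even-even and
  odd-odd products acquire the same factor. That common factor depends on the lengths only through
  \<open>M - L\<close> and leaves a Hermitian inner product of the data.\<close>

lemma midpoint_form_wronskian:
  assumes f: "midpoint_form k L f a b" and g: "midpoint_form k M g a' b'" and "L > 0" "M > 0"
  shows "(vector_derivative f (at L within {0..L}) * cnj (g M) -
      f L * cnj (vector_derivative g (at M within {0..M}))) -
    (vector_derivative f (at 0 within {0..L}) * cnj (g 0) -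
      f 0 * cnj (vector_derivative g (at 0 within {0..M}))) =
    of_real (2 * k * sin (k * (M - L) / 2)) * (a * cnj a' + b * cnj b')"
proof -
  define C where "C = complex_of_real (cos (k * L / 2))"
  define S where "S = complex_of_real (sin (k * L / 2))"
  define C' where "C' = complex_of_real (cos (k * M / 2))"
  define S' where "S' = complex_of_real (sin (k * M / 2))"
  have cnj: "cnj C' = C'" "cnj S' = S'" by (simp_all add: C'_def S'_def)
  have ang: "k * (N - N / 2) = k * N / 2" "k * (0 - N / 2) = - (k * N / 2)" for N
    by (simp_all add: algebra_simps)
  have fL: "f L = a * C + b * S" "vector_derivative f (at L within {0..L}) = of_real k * (b * C - a * S)"
    and f0: "f 0 = a * C - b * S" "vector_derivative f (at 0 within {0..L}) = of_real k * (b * C + a * S)"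
    using f \<open>L > 0\<close> bspec[of "{0..L}" _ L] bspec[of "{0..L}" _ 0]
    unfolding midpoint_form_def C_def S_def by (auto simp: ang simp del: mult_minus_right)
  have gM: "g M = a' * C' + b' * S'" "vector_derivative g (at M within {0..M}) = of_real k * (b' * C' - a' * S')"
    and g0: "g 0 = a' * C' - b' * S'" "vector_derivative g (at 0 within {0..M}) = of_real k * (b' * C' + a' * S')"
    using g \<open>M > 0\<close> unfolding midpoint_form_def C'_def S'_def
    by (auto simp: ang simp del: mult_minus_right)
  have "k * (M - L) / 2 = k * M / 2 - k * L / 2" by (simp add: field_simps)
  then have "sin (k * (M - L) / 2) =
      sin (k * M / 2) * cos (k * L / 2) - cos (k * M / 2) * sin (k * L / 2)"
    by (simp only: sin_diff)
  then have sin: "of_real (2 * k * sin (k * (M - L) / 2)) = 2 * of_real k * (S' * C - C' * S)"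
    unfolding C_def S_def C'_def S'_def by simp
  show ?thesis
    unfolding fL f0 gM g0 sin by (simp add: cnj) (simp add: algebra_simps)
qed

text \<open>Green's identity, summed edge by edge through the Wronskian formula. Edges of equal
  length drop out, and if all others change by the same amount the sine can be pulled out of the
  sum.\<close>

lemma (in fin_digraph) midpoint_data_orthogonality:
  assumes u: "u \<in> eigenspace G bc \<l> (k\<^sup>2)" and v: "v \<in> eigenspace G bc \<l>' (k\<^sup>2)"
    and pos: "\<forall>e \<in> arcs G. \<l> e > 0" "\<forall>e \<in> arcs G. \<l>' e > 0"
    and mu: "\<And>e. e \<in> arcs G \<Longrightarrow> midpoint_form k (\<l> e) (u e) (a e) (b e)"
    and mv: "\<And>e. e \<in> arcs G \<Longrightarrow> midpoint_form k (\<l>' e) (v e) (a' e) (b' e)"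
  shows "(\<Sum>e\<in>arcs G. of_real (2 * k * sin (k * (\<l>' e - \<l> e) / 2)) *
    (a e * cnj (a' e) + b e * cnj (b' e))) = 0"
proof -
  have "vertex_conditions G bc \<l> u" "vertex_conditions G bc \<l>' v"
    using u v by (simp_all add: eigenspace_def neg_laplacian_def)
  note green = green_identity[OF this]
  have "(\<Sum>e\<in>arcs G. of_real (2 * k * sin (k * (\<l>' e - \<l> e) / 2)) *
      (a e * cnj (a' e) + b e * cnj (b' e))) =
    (\<Sum>e\<in>arcs G. (edge_deriv \<l> u e (\<l> e) * cnj (v e (\<l>' e)) -
        u e (\<l> e) * cnj (edge_deriv \<l>' v e (\<l>' e))) -
      (edge_deriv \<l> u e 0 * cnj (v e 0) - u e 0 * cnj (edge_deriv \<l>' v e 0)))"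
    using pos by (intro sum.cong refl midpoint_form_wronskian[symmetric] mu mv) auto
  also have "\<dots> = 0"
    using green by (simp only: sum_subtractf right_minus_eq)
  finally show ?thesis .
qed

section \<open>Functions that vanish off \<open>K\<close>\<close>

text \<open>The zero function solves the equation on an edge of any length and contributes zero end
  values and derivatives, so changing lengths off \<open>K\<close> affects no condition.\<close>

lemma eigenspace_change_lengths:
  assumes u: "u \<in> eigenspace G bc \<l> \<mu>"
    and van: "\<And>e. e \<in> arcs G - K \<Longrightarrow> u e = (\<lambda>x. 0)"
    and eq: "\<And>e. e \<in> K \<Longrightarrow> \<l>' e = \<l> e"
    and pos: "\<forall>e \<in> arcs G. \<l> e > 0" "\<forall>e \<in> arcs G. \<l>' e > 0"
  shows "u \<in> eigenspace G bc \<l>' \<mu>"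
proof -
  have val: "u e (\<l>' e) = u e (\<l> e)" if "e \<in> arcs G" for e
    using van eq that by (cases "e \<in> K") auto
  \<comment> \<open>On a one-point interval the derivative would be an arbitrary choice, hence
    \<open>L > 0\<close>.\<close>
  have zero: "vector_derivative (\<lambda>x. 0 :: complex) (at x within {0..L}) = 0"
    if "L > 0" "x \<in> {0..L}" for x L :: real
    using vector_derivative_within_cbox[of 0 L x "\<lambda>x. 0" 0] that by simp
  have der: "edge_deriv \<l>' u e (\<l>' e) = edge_deriv \<l> u e (\<l> e)"
    "edge_deriv \<l>' u e 0 = edge_deriv \<l> u e 0" if "e \<in> arcs G" for e
  proof -
    have "edge_deriv \<l>' u e (\<l>' e) = edge_deriv \<l> u e (\<l> e) \<and>
        edge_deriv \<l>' u e 0 = edge_deriv \<l> u e 0"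
    proof (cases "e \<in> K")
      case True
      then show ?thesis by (simp add: eq)
    next
      case False
      then have "u e = (\<lambda>x. 0)" using van that by blast
      then show ?thesis using pos that by (simp add: zero less_imp_le)
    qed
    then show "edge_deriv \<l>' u e (\<l>' e) = edge_deriv \<l> u e (\<l> e)"
      "edge_deriv \<l>' u e 0 = edge_deriv \<l> u e 0" by auto
  qed
  have hv: "has_vertex_value G \<l>' u = has_vertex_value G \<l> u"
    by (intro ext) (auto simp: has_vertex_value_def val)
  have nds: "normal_derivative_sum G \<l>' u = normal_derivative_sum G \<l> u"
    by (intro ext) (auto simp: normal_derivative_sum_def der intro!: arg_cong2[where f = "(-)"] sum.cong)
  have "has_H2_second_derivative (\<l>' e) (u e) (\<lambda>x. - scale_fun (of_real \<mu>) u e x)"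
    if e: "e \<in> arcs G" for e
  proof (cases "e \<in> K")
    case True
    then show ?thesis
      using u e by (simp add: eigenspace_def neg_laplacian_def eq)
  next
    case False
    then have "u e = (\<lambda>x. 0)" using van e by blast
    then show ?thesis
      by (auto simp: scale_fun_def has_H2_second_derivative_def square_integrable_on_def
          set_integrable_def set_borel_measurable_def set_lebesgue_integral_def intro!: exI[of _ "\<lambda>_. 0"])
  qed
  moreover have "u \<in> graph_functions G \<l>'"
    unfolding graph_functions_def
  proof (intro CollectI allI impI)
    fix e x assume ex: "\<not> (e \<in> arcs G \<and> x \<in> {0..\<l>' e})"
    have u0: "u e x = 0" if "\<not> (e \<in> arcs G \<and> x \<in> {0..\<l> e})"
      using u that unfolding eigenspace_def graph_functions_def by blast
    show "u e x = 0"
    proof (cases "e \<in> arcs G - K")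
      case True
      then show ?thesis by (simp add: van)
    next
      case False
      then show ?thesis using ex eq[of e] by (intro u0) auto
    qed
  qed
  moreover have "vertex_conditions G bc \<l>' u"
    using u unfolding eigenspace_def neg_laplacian_def vertex_conditions_def hv nds by blast
  ultimately show ?thesis
    by (simp add: eigenspace_def neg_laplacian_def)
qed

text \<open>Edge intervals are closed, so taking closures never leaves an edge, and graph functions
  are normalised to zero off the arcs, so \<open>e\<close> may range over the whole type.\<close>

lemma graph_support_subset_iff:
  assumes "u \<in> graph_functions G \<l>" "K \<subseteq> arcs G"
  shows "graph_support G \<l> u \<subseteq> edge_points \<l> K \<longleftrightarrow> (\<forall>e. e \<notin> K \<longrightarrow> u e = (\<lambda>x. 0))"
proof
  assume sub: "graph_support G \<l> u \<subseteq> edge_points \<l> K"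
  show "\<forall>e. e \<notin> K \<longrightarrow> u e = (\<lambda>x. 0)"
  proof (intro allI impI ext)
    fix e x assume "e \<notin> K"
    show "u e x = 0"
    proof (rule ccontr)
      assume "u e x \<noteq> 0"
      then have "e \<in> arcs G" "x \<in> {0..\<l> e}"
        using assms(1) unfolding graph_functions_def by blast+
      with \<open>u e x \<noteq> 0\<close> have "(e, x) \<in> graph_support G \<l> u"
        unfolding graph_support_def by (auto intro: closure_subset[THEN subsetD])
      with sub \<open>e \<notin> K\<close> show False unfolding edge_points_def by blast
    qed
  qed
next
  assume "\<forall>e. e \<notin> K \<longrightarrow> u e = (\<lambda>x. 0)"
  moreover have "closure {x \<in> {0..\<l> e}. u e x \<noteq> 0} \<subseteq> {0..\<l> e}" for e
    by (rule closure_minimal) auto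
  ultimately show "graph_support G \<l> u \<subseteq> edge_points \<l> K"
    unfolding graph_support_def edge_points_def by fastforce
qed

section \<open>Finiteness of the exceptional lengthenings\<close>

text \<open>Each exceptional parameter provides a nonzero vector of midpoint data off
  \<open>K\<close>, and these are pairwise orthogonal. The cap \<open>2 * pi / k\<close> keeps
  \<open>k * (t - s) / 2\<close> strictly between \<open>-pi\<close> and \<open>pi\<close>, where
  the sine vanishes only for \<open>s = t\<close>.\<close>

lemma (in fin_digraph) finite_nonvanishing_lengths:
  assumes "k > 0" and pos: "\<forall>e \<in> arcs G. \<l> e > 0"
  shows "finite {t. 0 < t \<and> t < 2 * pi / k \<and>
    (\<exists>u \<in> eigenspace G bc (\<lambda>e. if e \<in> K then \<l> e else \<l> e + t) (k\<^sup>2).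
       \<exists>e \<in> arcs G - K. u e \<noteq> (\<lambda>x. 0))}" (is "finite ?T")
proof -
  define \<l>t where "\<l>t t e = (if e \<in> K then \<l> e else \<l> e + t)" for t e
  have post: "\<forall>e \<in> arcs G. \<l>t t e > 0" if "t > 0" for t
    using pos that by (auto simp: \<l>t_def add_pos_pos)
  have "\<forall>t\<in>?T. \<exists>u a b. u \<in> eigenspace G bc (\<l>t t) (k\<^sup>2) \<and> (\<exists>e \<in> arcs G - K. u e \<noteq> (\<lambda>x. 0)) \<and>
      (\<forall>e \<in> arcs G. midpoint_form k (\<l>t t e) (u e) (a e) (b e))"
  proof
    fix t assume t: "t \<in> ?T"
    obtain u where u: "u \<in> eigenspace G bc (\<l>t t) (k\<^sup>2)" "\<exists>e \<in> arcs G - K. u e \<noteq> (\<lambda>x. 0)"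
      using t unfolding \<l>t_def by blast
    obtain a b where "\<And>e. e \<in> arcs G \<Longrightarrow> midpoint_form k (\<l>t t e) (u e) (a e) (b e)"
      using eigenspace_midpoint_form[OF u(1) \<open>k > 0\<close> post] t by blast
    with u show "\<exists>u a b. u \<in> eigenspace G bc (\<l>t t) (k\<^sup>2) \<and> (\<exists>e \<in> arcs G - K. u e \<noteq> (\<lambda>x. 0)) \<and>
      (\<forall>e \<in> arcs G. midpoint_form k (\<l>t t e) (u e) (a e) (b e))" by blast
  qed
  then obtain u a b where uab: "\<forall>t\<in>?T. u t \<in> eigenspace G bc (\<l>t t) (k\<^sup>2) \<and>
      (\<exists>e \<in> arcs G - K. u t e \<noteq> (\<lambda>x. 0)) \<and>
      (\<forall>e \<in> arcs G. midpoint_form k (\<l>t t e) (u t e) (a t e) (b t e))"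
    unfolding bchoice_iff by blast
  then have u: "\<And>t. t \<in> ?T \<Longrightarrow> u t \<in> eigenspace G bc (\<l>t t) (k\<^sup>2)"
    and nz: "\<And>t. t \<in> ?T \<Longrightarrow> \<exists>e \<in> arcs G - K. u t e \<noteq> (\<lambda>x. 0)"
    and mf: "\<And>t e. t \<in> ?T \<Longrightarrow> e \<in> arcs G \<Longrightarrow> midpoint_form k (\<l>t t e) (u t e) (a t e) (b t e)"
    by blast+
  \<comment> \<open>Two coordinates per edge off \<open>K\<close>: \<open>True\<close> selects the
    cosine coefficient, \<open>False\<close> the sine coefficient.\<close>
  define I where "I = (arcs G - K) \<times> (UNIV :: bool set)"
  define w where "w t = (\<lambda>(e, z). if z then a t e else b t e)" for t
  have "finite I" unfolding I_def by auto
  have w_sum: "(\<Sum>i\<in>I. w s i * cnj (w t i)) =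
      (\<Sum>e\<in>arcs G - K. a s e * cnj (a t e) + b s e * cnj (b t e))" for s t
    unfolding I_def w_def sum.cartesian_product' by (simp add: UNIV_bool add.commute)
  have orth: "(\<Sum>i\<in>I. w s i * cnj (w t i)) = 0" if st: "s \<in> ?T" "t \<in> ?T" "s \<noteq> t" for s t
  proof -
    have "0 = (\<Sum>e\<in>arcs G. of_real (2 * k * sin (k * (\<l>t t e - \<l>t s e) / 2)) *
        (a s e * cnj (a t e) + b s e * cnj (b t e)))"
      by (rule midpoint_data_orthogonality[OF u[OF st(1)] u[OF st(2)] _ _ mf[OF st(1)] mf[OF st(2)],
            symmetric]) (use st post in auto)
    \<comment> \<open>On \<open>K\<close> both length vectors agree, so the sine factor is zero
      there; elsewhere they differ by \<open>t - s\<close>.\<close>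
    also have "\<dots> = (\<Sum>e\<in>arcs G - K. of_real (2 * k * sin (k * (t - s) / 2)) *
        (a s e * cnj (a t e) + b s e * cnj (b t e)))"
      by (rule sum.mono_neutral_cong_right) (auto simp: \<l>t_def)
    also have "\<dots> = of_real (2 * k * sin (k * (t - s) / 2)) * (\<Sum>i\<in>I. w s i * cnj (w t i))"
      by (simp add: w_sum sum_distrib_left)
    finally have "of_real (2 * k * sin (k * (t - s) / 2)) * (\<Sum>i\<in>I. w s i * cnj (w t i)) = 0"
      by simp
    moreover have "sin (k * (t - s) / 2) \<noteq> 0"
    proof -
      have "\<bar>t - s\<bar> < 2 * pi / k" using st by auto
      then have "k * \<bar>t - s\<bar> / 2 < pi"
        using \<open>k > 0\<close> by (simp add: pos_less_divide_eq mult.commute)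
      moreover have "\<bar>k * (t - s) / 2\<bar> = k * \<bar>t - s\<bar> / 2"
        using \<open>k > 0\<close> by (simp add: abs_mult)
      ultimately have "\<bar>k * (t - s) / 2\<bar> < pi" by simp
      moreover have "k * (t - s) / 2 \<noteq> 0" using st \<open>k > 0\<close> by simp
      ultimately show ?thesis using sin_eq_0_pi[of "k * (t - s) / 2"] by linarith
    qed
    ultimately show ?thesis using \<open>k > 0\<close> by simp
  qed
  have w_nz: "\<exists>i\<in>I. w t i \<noteq> 0" if t: "t \<in> ?T" for t
  proof (rule ccontr)
    assume "\<not> ?thesis"
    then have "w t (e, z) = 0" if "e \<in> arcs G - K" for e z
      using that unfolding I_def by blast
    from this[of _ True] this[of _ False]
    have zero: "a t e = 0" "b t e = 0" if "e \<in> arcs G - K" for e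
      using that unfolding w_def by simp_all
    \<comment> \<open>Zero data force \<open>u t\<close> to vanish on the edge interval, and the
      normalisation places every nonzero value inside that interval.\<close>
    obtain e x where e: "e \<in> arcs G - K" and x: "u t e x \<noteq> 0"
      using nz[OF t] by blast
    have "x \<in> {0..\<l>t t e}"
      using x u[OF t] e unfolding eigenspace_def graph_functions_def by blast
    then have "u t e x = 0"
      using mf[OF t, of e] e zero[OF e] unfolding midpoint_form_def by simp
    with x show False by contradiction
  qed
  \<comment> \<open>The dimension bound is uniform over finite subsets of the exceptional set, so
    that set is itself finite.\<close>
  have "finite ?T \<and> card ?T \<le> card I"
  proof (rule finite_if_finite_subsets_card_bdd)
    fix F assume "F \<subseteq> ?T" "finite F"
    then show "card F \<le> card I"
      by (intro card_orthogonal_le[OF _ \<open>finite I\<close>, of _ w] orth w_nz) auto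
  qed
  then show ?thesis by blast
qed

section \<open>Simplicity at a non-exceptional lengthening\<close>

theorem proposition4p1:
  fixes G :: "('v, 'e) pre_digraph"
    and bc :: "'v \<Rightarrow> boundary_condition"
    and K :: "'e set"
    and \<l>\<^sub>0 :: "'e \<Rightarrow> real"
    and k :: real
    and \<phi> :: "'e \<Rightarrow> real \<Rightarrow> complex"
  assumes "fin_digraph G"
    and "Digraph_Component.connected G"
    and "simple_exterior_path G K \<or> simple_cycle G K"
    and "K \<subset> arcs G"
    and "\<forall>e \<in> arcs G. \<l>\<^sub>0 e > 0"
    and "k > 0"
    and "eigenfunction G bc \<l>\<^sub>0 (k\<^sup>2) \<phi>"
    and "graph_support G \<l>\<^sub>0 \<phi> = edge_points \<l>\<^sub>0 K"
    and "one_dimensional_spanned_by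
           {u \<in> eigenspace G bc \<l>\<^sub>0 (k\<^sup>2). graph_support G \<l>\<^sub>0 u \<subseteq> edge_points \<l>\<^sub>0 K} \<phi>"
  shows "\<forall>\<epsilon>>0. \<exists>\<l> :: 'e \<Rightarrow> real.
           (\<forall>e \<in> arcs G. \<l> e > 0) \<and>
           (\<forall>e \<in> K. \<l> e = \<l>\<^sub>0 e) \<and>
           (\<forall>e \<in> arcs G - K. \<bar>\<l> e - \<l>\<^sub>0 e\<bar> < \<epsilon>) \<and>
           simple_eigenvalue G bc \<l> (k\<^sup>2) \<and>
           eigenfunction G bc \<l> (k\<^sup>2) (extend_by_zero K \<phi>)"
proof (intro allI impI)
  fix \<epsilon> :: real assume "\<epsilon> > 0"
  interpret fin_digraph G by fact
  let ?E = "\<lambda>\<l>. eigenspace G bc \<l> (k\<^sup>2)"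
  have sub: "K \<subseteq> arcs G" using assms(4) by blast
  let ?bad = "{t. 0 < t \<and> t < 2 * pi / k \<and>
    (\<exists>u \<in> ?E (\<lambda>e. if e \<in> K then \<l>\<^sub>0 e else \<l>\<^sub>0 e + t). \<exists>e \<in> arcs G - K. u e \<noteq> (\<lambda>x. 0))}"
  \<comment> \<open>Infinitely many parameters are small enough, only finitely many are exceptional,
    so an admissible \<open>t\<close> exists.\<close>
  have "infinite {0<..<min \<epsilon> (2 * pi / k)}"
    using \<open>\<epsilon> > 0\<close> \<open>k > 0\<close> by (intro infinite_Ioo) simp
  then have "\<not> {0<..<min \<epsilon> (2 * pi / k)} \<subseteq> ?bad"
    using finite_nonvanishing_lengths[OF assms(6,5)] finite_subset by blast
  then obtain t where t_Ioo: "t \<in> {0<..<min \<epsilon> (2 * pi / k)}" and "t \<notin> ?bad"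
    unfolding subset_iff not_all not_imp by blast
  then have t: "0 < t" "t < \<epsilon>" by simp_all
  have van: "u e = (\<lambda>x. 0)"
    if "u \<in> ?E (\<lambda>e. if e \<in> K then \<l>\<^sub>0 e else \<l>\<^sub>0 e + t)" "e \<in> arcs G - K" for u e
    using \<open>t \<notin> ?bad\<close> t_Ioo that unfolding mem_Collect_eq greaterThanLessThan_iff min_less_iff_conj by blast
  define \<l> where "\<l> e = (if e \<in> K then \<l>\<^sub>0 e else \<l>\<^sub>0 e + t)" for e
  have pos: "\<forall>e \<in> arcs G. \<l> e > 0"
    using assms(5) t by (auto simp: \<l>_def add_pos_pos)
  have gf: "u \<in> graph_functions G \<l>'" if "u \<in> ?E \<l>'" for u \<l>'
    using that by (simp add: eigenspace_def)
  have \<phi>: "\<phi> \<in> ?E \<l>\<^sub>0" "\<phi> \<noteq> (\<lambda>e x. 0)"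
    using assms(7) by (simp_all add: eigenfunction_def)
  have \<phi>_van: "\<phi> e = (\<lambda>x. 0)" if "e \<notin> K" for e
    using graph_support_subset_iff[OF gf[OF \<phi>(1)] sub] assms(8) that by blast
  \<comment> \<open>This carries the one-dimensionality assumption over to the new lengths. The
    choice of \<open>t\<close> makes every new eigenfunction vanish off \<open>K\<close>, and
    functions vanishing there pass between the two length vectors in both directions.\<close>
  have "?E \<l> = {u \<in> ?E \<l>\<^sub>0. graph_support G \<l>\<^sub>0 u \<subseteq> edge_points \<l>\<^sub>0 K}"
  proof (intro equalityI subsetI)
    fix u assume u: "u \<in> ?E \<l>"
    have van': "u e = (\<lambda>x. 0)" if "e \<notin> K" for e
    proof (cases "e \<in> arcs G")
      case True
      then show ?thesis using van[OF u[unfolded \<l>_def]] that by blast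
    next
      case False
      then show ?thesis using gf[OF u] unfolding graph_functions_def by blast
    qed
    have "u \<in> ?E \<l>\<^sub>0"
      by (rule eigenspace_change_lengths[OF u _ _ pos assms(5), of K]) (auto simp: van' \<l>_def)
    then show "u \<in> {u \<in> ?E \<l>\<^sub>0. graph_support G \<l>\<^sub>0 u \<subseteq> edge_points \<l>\<^sub>0 K}"
      using graph_support_subset_iff[OF gf sub] van' by blast
  next
    fix u assume u: "u \<in> {u \<in> ?E \<l>\<^sub>0. graph_support G \<l>\<^sub>0 u \<subseteq> edge_points \<l>\<^sub>0 K}"
    then have "u e = (\<lambda>x. 0)" if "e \<notin> K" for e
      using graph_support_subset_iff[OF gf sub] that by blast
    then show "u \<in> ?E \<l>"
      using u by (intro eigenspace_change_lengths[OF _ _ _ assms(5) pos, of u bc _ K]) (auto simp: \<l>_def)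
  qed
  then have span: "one_dimensional_spanned_by (?E \<l>) \<phi>" using assms(9) by simp
  have "\<phi> \<in> ?E \<l>"
    by (rule eigenspace_change_lengths[OF \<phi>(1) _ _ assms(5) pos, of K]) (auto simp: \<phi>_van \<l>_def)
  moreover have "extend_by_zero K \<phi> = \<phi>"
    unfolding extend_by_zero_def by (intro ext) (simp add: \<phi>_van)
  ultimately have "eigenfunction G bc \<l> (k\<^sup>2) (extend_by_zero K \<phi>)"
    using \<phi>(2) by (simp add: eigenfunction_def)
  then show "\<exists>\<l>. (\<forall>e \<in> arcs G. \<l> e > 0) \<and> (\<forall>e \<in> K. \<l> e = \<l>\<^sub>0 e) \<and>
      (\<forall>e \<in> arcs G - K. \<bar>\<l> e - \<l>\<^sub>0 e\<bar> < \<epsilon>) \<and> simple_eigenvalue G bc \<l> (k\<^sup>2) \<and>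
      eigenfunction G bc \<l> (k\<^sup>2) (extend_by_zero K \<phi>)"
    using pos span t unfolding simple_eigenvalue_def
    by (intro exI[of _ \<l>]) (auto simp: \<l>_def)
qed

end
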